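(* Let $n\ge2$, $s_1\in(0,1)$, and let $a_1:\partial B_1\to\mathbb{R}$ be a continuous function on the unit sphere $\partial B_1\subset\mathbb{R}^n$, bounded from above and below by two positive constants and satisfying $a_1(\omega)=a_1(-\omega)$ for all $\omega\in\partial B_1$. Given $\vartheta\in(0,\pi)$, for every $\bar\vartheta\in(0,2\pi)$ let $$\mathcal{D}_\vartheta(\bar\vartheta):=\int_{J_{\vartheta,\vartheta+\bar\vartheta}}\frac{a_1(\overrightarrow{x-e(\vartheta)})}{|x-e(\vartheta)|^{n+s_1}}\,dx-\int_{J_{0,\vartheta}}\frac{a_1(\overrightarrow{x-e(\vartheta)})}{|x-e(\vartheta)|^{n+s_1}}\,dx .$$ Then: (a) $\mathcal{D}_\vartheta$ is well-defined in the principal value sense (that is, the limit defining it exists and is finite for every $\bar\vartheta\in(0,2\pi)$); (b) $\mathcal{D}_\vartheta$ is continuous in $(0,2\pi)$; (c) $\lim_{\bar\vartheta\searrow0}\mathcal{D}_\vartheta(\bar\vartheta)=-\infty$; (d) $\lim_{\bar\vartheta\nearrow2\pi}\mathcal{D}_\vartheta(\bar\vartheta)=+\infty$. Moreover, for every $c\in\mathbb{R}$ and every angle $\vartheta\in(0,\pi)$ there exists a unique angle $\widehat\vartheta\in(0,2\pi)$ such that $\mathcal{D}_\vartheta(\widehat\vartheta)=c$.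
   Context: For $\zeta\in\mathbb{R}^n\setminus\{0\}$, $\overrightarrow{\zeta}:=\zeta/|\zeta|$. For an angle $\alpha$, $e(\alpha):=\cos\alpha\,e_1+\sin\alpha\,e_n$, where $e_1,\dots,e_n$ is the standard basis of $\mathbb{R}^n$. For real angles $\vartheta_1<\vartheta_2\le\vartheta_1+2\pi$, $$J_{\vartheta_1,\vartheta_2}:=\{x\in\mathbb{R}^n:\ \exists\,\beta\in(\vartheta_1,\vartheta_2),\ \rho>0\ \text{such that}\ (x_1,x_n)=\rho(\cos\beta,\sin\beta)\}.$$ The principal value meaning of $\mathcal{D}_\vartheta(\bar\vartheta)$ is $$\mathcal{D}_\vartheta(\bar\vartheta)=\lim_{\rho\searrow0}\left(\int_{J_{\vartheta,\vartheta+\bar\vartheta}\setminus B_\rho(e(\vartheta))}\frac{a_1(\overrightarrow{x-e(\vartheta)})}{|x-e(\vartheta)|^{n+s_1}}\,dx-\int_{J_{0,\vartheta}\setminus B_\rho(e(\vartheta))}\frac{a_1(\overrightarrow{x-e(\vartheta)})}{|x-e(\vartheta)|^{n+s_1}}\,dx\right).$$ *)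

theory Defs
  imports "HOL-Analysis.Analysis"
begin

text \<open>
  The ambient space is \<open>real ^ 'n\<close> with \<open>n = CARD('n)\<close>. Since the index type carries no order, the
  first and the last index are explicit parameters \<open>i1\<close> and \<open>iN\<close>; the condition \<open>n \<ge> 2\<close>
  is expressed by requiring \<open>i1 \<noteq> iN\<close> wherever it is needed.
\<close>

definition unit_dir :: "'n::finite \<Rightarrow> 'n \<Rightarrow> real \<Rightarrow> real ^ 'n" where
  "unit_dir i1 iN \<alpha> = cos \<alpha> *\<^sub>R axis i1 1 + sin \<alpha> *\<^sub>R axis iN 1"

definition sector :: "'n::finite \<Rightarrow> 'n \<Rightarrow> real \<Rightarrow> real \<Rightarrow> (real ^ 'n) set" where
  "sector i1 iN \<theta>1 \<theta>2 =
     {x. \<exists>\<beta> \<rho>. \<theta>1 < \<beta> \<and> \<beta> < \<theta>2 \<and> 0 < \<rho> \<and> x $ i1 = \<rho> * cos \<beta> \<and> x $ iN = \<rho> * sin \<beta>}"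

text \<open>
  The direction \<open>z / norm z\<close> of a nonzero vector is \<open>sgn z\<close>. Only the values of \<open>a\<close> on
  \<open>sphere 0 1\<close> matter, because the singularity \<open>x = p\<close> is always removed from the domain
  of integration below.
\<close>

definition kernel :: "real \<Rightarrow> (real ^ 'n \<Rightarrow> real) \<Rightarrow> real ^ 'n \<Rightarrow> real ^ 'n::finite \<Rightarrow> real" where
  "kernel s a p x = a (sgn (x - p)) / norm (x - p) powr (real CARD('n) + s)"

definition trunc_D ::
    "'n::finite \<Rightarrow> 'n \<Rightarrow> real \<Rightarrow> (real ^ 'n \<Rightarrow> real) \<Rightarrow> real \<Rightarrow> real \<Rightarrow> real \<Rightarrow> real" where
  "trunc_D i1 iN s a \<theta> \<phi> \<rho> =
     (LINT x : sector i1 iN \<theta> (\<theta> + \<phi>) - ball (unit_dir i1 iN \<theta>) \<rho> | lborel.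
        kernel s a (unit_dir i1 iN \<theta>) x)
   - (LINT x : sector i1 iN 0 \<theta> - ball (unit_dir i1 iN \<theta>) \<rho> | lborel.
        kernel s a (unit_dir i1 iN \<theta>) x)"

text \<open>
  Bochner integrals of non-integrable functions are \<open>0\<close>, so being well defined includes
  absolute convergence of both truncated integrals, not just existence of the limit.
\<close>

definition D_well_defined ::
    "'n::finite \<Rightarrow> 'n \<Rightarrow> real \<Rightarrow> (real ^ 'n \<Rightarrow> real) \<Rightarrow> real \<Rightarrow> real \<Rightarrow> bool" where
  "D_well_defined i1 iN s a \<theta> \<phi> \<longleftrightarrow>
     (\<forall>\<rho>>0. set_integrable lborel (sector i1 iN \<theta> (\<theta> + \<phi>) - ball (unit_dir i1 iN \<theta>) \<rho>)
                (kernel s a (unit_dir i1 iN \<theta>))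
          \<and> set_integrable lborel (sector i1 iN 0 \<theta> - ball (unit_dir i1 iN \<theta>) \<rho>)
                (kernel s a (unit_dir i1 iN \<theta>)))
   \<and> (\<exists>L. (trunc_D i1 iN s a \<theta> \<phi> \<longlongrightarrow> L) (at_right 0))"

definition D_pv ::
    "'n::finite \<Rightarrow> 'n \<Rightarrow> real \<Rightarrow> (real ^ 'n \<Rightarrow> real) \<Rightarrow> real \<Rightarrow> real \<Rightarrow> real" where
  "D_pv i1 iN s a \<theta> \<phi> = Lim (at_right 0) (trunc_D i1 iN s a \<theta> \<phi>)"

end

theory Submission
  imports Defs "HOL-Probability.Distribution_Functions"
begin

text \<open>
  Write \<open>p\<close> for the point \<open>e(\<theta>)\<close> and let \<open>h x\<close> in \<open>[0, 2\<pi>)\<close> be the angle of the planar part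
  of \<open>x\<close>, measured from the direction of \<open>p\<close>. Up to a full turn, both sectors are preimages of intervals
  under \<open>h\<close>: the first is \<open>0 < h < \<phi>\<close> and the second is \<open>2\<pi> - \<theta> < h < 2\<pi>\<close>. Let \<open>\<mu>\<close> be the
  measure whose Lebesgue density is the kernel centred at \<open>p\<close>. The kernel decays like \<open>r\<close> to the power
  \<open>-(n + s)\<close>, so \<open>\<mu>\<close> is finite off every ball about \<open>p\<close>
  (\<open>emeasure_kernel_measure_off_ball\<close>), but it has infinite mass near \<open>p\<close> in each of the half-spaces
  \<open>0 < h < \<pi>\<close> and \<open>\<pi> < h\<close> (\<open>emeasure_half_ball\<close>).

  Near \<open>p\<close> the angle \<open>h\<close> only takes values close to \<open>0\<close> or to \<open>2\<pi>\<close>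
  (\<open>rel_angle_avoids_near_unit_dir\<close>), so there the two sectors coincide with these opposite half-spaces. The
  kernel is even about \<open>p\<close>, and the point reflection about \<open>p\<close> exchanges the two half-spaces.
  Hence the contributions of a thin annulus to the two integrals cancel exactly, and the truncated
  difference does not depend on the truncation radius once that radius is small
  (\<open>trunc_D_eventually_constant\<close>). The principal value is therefore attained, not just approached.

  Comparing two angles at a common small radius gives
  \<open>D \<beta> = D \<alpha> + \<mu> {\<alpha> \<le> h < \<beta>}\<close> (\<open>D_increment\<close>), and all other assertions follow from this:
  \<open>D\<close> is strictly increasing because nonempty open sets have positive \<open>\<mu>\<close>-measure, it is continuous
  because \<open>D\<close> is locally a distribution function without atoms, and it tends to \<open>-\<infinity>\<close> and \<open>+\<infinity>\<close>
  because the wedges \<open>0 < h < \<pi>\<close> and \<open>\<pi> < h\<close> have infinite mass. Existence and uniqueness of the solution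
  of \<open>D \<phi> = c\<close> are then the intermediate value theorem and strict monotonicity.
\<close>

section \<open>Angles relative to a fixed direction\<close>

text \<open>
  The plane is identified with the complex numbers and turned so that the direction \<open>\<theta>\<close> becomes the
  positive real axis. The cut of \<open>Arg2pi\<close> then lies on the ray through the singularity, so the sectors
  adjacent to that ray from either side are given by inequalities between angles, without case
  distinctions.
\<close>

definition rotated_plane :: "'n::finite \<Rightarrow> 'n \<Rightarrow> real \<Rightarrow> real ^ 'n \<Rightarrow> complex" where
  "rotated_plane i1 iN \<theta> x = Complex (x $ i1) (x $ iN) * cis (- \<theta>)"

definition rel_angle :: "'n::finite \<Rightarrow> 'n \<Rightarrow> real \<Rightarrow> real ^ 'n \<Rightarrow> real" where
  "rel_angle i1 iN \<theta> x = Arg2pi (rotated_plane i1 iN \<theta> x)"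

lemma continuous_on_rotated_plane [continuous_intros]:
  "continuous_on A (rotated_plane i1 iN \<theta>)"
  unfolding rotated_plane_def Complex_eq by (intro continuous_intros)

lemma rotated_plane_unit_dir:
  assumes "i1 \<noteq> iN"
  shows "rotated_plane i1 iN \<theta> (unit_dir i1 iN \<gamma>) = cis (\<gamma> - \<theta>)"
proof -
  have "Complex (unit_dir i1 iN \<gamma> $ i1) (unit_dir i1 iN \<gamma> $ iN) = cis \<gamma>"
    using assms by (simp add: unit_dir_def axis_def complex_eq_iff)
  then show ?thesis
    by (simp add: rotated_plane_def cis_mult)
qed

lemma rotated_plane_diff:
  "rotated_plane i1 iN \<theta> (x - y) = rotated_plane i1 iN \<theta> x - rotated_plane i1 iN \<theta> y"
  by (simp add: rotated_plane_def complex_eq_iff algebra_simps)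

lemma rotated_plane_scaleR:
  "rotated_plane i1 iN \<theta> (c *\<^sub>R x) = c *\<^sub>R rotated_plane i1 iN \<theta> x"
  by (simp add: rotated_plane_def complex_eq_iff algebra_simps)

lemma norm_unit_dir:
  assumes "i1 \<noteq> iN" shows "norm (unit_dir i1 iN \<gamma>) = 1"
proof -
  have "unit_dir i1 iN \<gamma> \<bullet> unit_dir i1 iN \<gamma> = cos \<gamma> * cos \<gamma> + sin \<gamma> * sin \<gamma>"
    using assms by (simp add: unit_dir_def inner_add_left inner_add_right inner_axis_axis)
  also have "\<dots> = 1"
    using sin_cos_squared_add3 by simp
  finally show ?thesis
    by (simp add: norm_eq_1)
qed

lemma Im_rotated_plane:
  "Im (rotated_plane i1 iN \<theta> x) = unit_dir i1 iN (\<theta> + pi / 2) \<bullet> x"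
  by (simp add: rotated_plane_def unit_dir_def inner_diff_left inner_axis' cos_add sin_add)

lemma Arg2pi_cis: "0 < r \<Longrightarrow> 0 \<le> t \<Longrightarrow> t < 2 * pi \<Longrightarrow> Arg2pi (of_real r * cis t) = t"
  by (rule Arg2pi_unique[of r]) (auto simp: cis_conv_exp)

lemma Arg2pi_polar: "z = of_real (cmod z) * cis (Arg2pi z)"
  by (simp add: complex_eq_iff cos_Arg2pi sin_Arg2pi)

text \<open>
  Points with vanishing planar part need no separate treatment: \<open>Arg2pi 0 = 0\<close> and \<open>0 \<le> \<alpha>\<close>, so the strict
  inequality excludes them, as the condition \<open>0 < \<rho>\<close> does in the definition of a sector.
\<close>

lemma sector_conv_rel_angle:
  assumes "0 \<le> \<alpha>" "\<beta> \<le> 2 * pi"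
  shows "sector i1 iN (\<theta> + \<alpha>) (\<theta> + \<beta>) = {x. \<alpha> < rel_angle i1 iN \<theta> x \<and> rel_angle i1 iN \<theta> x < \<beta>}"
proof (intro set_eqI iffI)
  fix x :: "real ^ 'a"
  assume "x \<in> sector i1 iN (\<theta> + \<alpha>) (\<theta> + \<beta>)"
  then obtain \<gamma> \<rho> where *: "\<theta> + \<alpha> < \<gamma>" "\<gamma> < \<theta> + \<beta>" "0 < \<rho>" "x $ i1 = \<rho> * cos \<gamma>" "x $ iN = \<rho> * sin \<gamma>"
    unfolding sector_def by blast
  have "Complex (x $ i1) (x $ iN) = of_real \<rho> * cis \<gamma>"
    using * by (simp add: complex_eq_iff)
  then have "rotated_plane i1 iN \<theta> x = of_real \<rho> * cis (\<gamma> - \<theta>)"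
    by (simp add: rotated_plane_def mult.assoc cis_mult)
  then have "rel_angle i1 iN \<theta> x = \<gamma> - \<theta>"
    using * assms by (simp add: rel_angle_def Arg2pi_cis del: Arg2pi_times_of_real)
  then show "x \<in> {x. \<alpha> < rel_angle i1 iN \<theta> x \<and> rel_angle i1 iN \<theta> x < \<beta>}"
    using * by auto
next
  fix x :: "real ^ 'a"
  assume "x \<in> {x. \<alpha> < rel_angle i1 iN \<theta> x \<and> rel_angle i1 iN \<theta> x < \<beta>}"
  then have x: "\<alpha> < rel_angle i1 iN \<theta> x" "rel_angle i1 iN \<theta> x < \<beta>" by auto
  define z where "z = rotated_plane i1 iN \<theta> x"
  have h: "rel_angle i1 iN \<theta> x = Arg2pi z" by (simp add: z_def rel_angle_def)
  then have "z \<noteq> 0" using x assms by auto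
  have "Complex (x $ i1) (x $ iN) = z * cis \<theta>"
    by (simp add: z_def rotated_plane_def mult.assoc cis_mult)
  also have "\<dots> = of_real (cmod z) * cis (\<theta> + Arg2pi z)"
    by (subst Arg2pi_polar) (simp add: mult.assoc cis_mult add.commute)
  finally have "x $ i1 = cmod z * cos (\<theta> + Arg2pi z) \<and> x $ iN = cmod z * sin (\<theta> + Arg2pi z)"
    by (simp add: complex_eq_iff)
  then show "x \<in> sector i1 iN (\<theta> + \<alpha>) (\<theta> + \<beta>)"
    unfolding sector_def using x h \<open>z \<noteq> 0\<close>
    by (intro CollectI exI[of _ "\<theta> + Arg2pi z"] exI[of _ "cmod z"]) auto
qed

lemma sector_periodic: "sector i1 iN (\<alpha> + 2 * pi) (\<beta> + 2 * pi) = sector i1 iN \<alpha> \<beta>"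
proof (intro set_eqI iffI)
  fix x
  assume "x \<in> sector i1 iN (\<alpha> + 2 * pi) (\<beta> + 2 * pi)"
  then obtain \<gamma> \<rho> where *: "\<alpha> + 2 * pi < \<gamma>" "\<gamma> < \<beta> + 2 * pi" "0 < \<rho>" "x $ i1 = \<rho> * cos \<gamma>" "x $ iN = \<rho> * sin \<gamma>"
    unfolding sector_def by blast
  then show "x \<in> sector i1 iN \<alpha> \<beta>"
    unfolding sector_def
    by (intro CollectI exI[of _ "\<gamma> - 2 * pi"] exI[of _ \<rho>]) (auto simp: cos_diff sin_diff)
next
  fix x
  assume "x \<in> sector i1 iN \<alpha> \<beta>"
  then obtain \<gamma> \<rho> where *: "\<alpha> < \<gamma>" "\<gamma> < \<beta>" "0 < \<rho>" "x $ i1 = \<rho> * cos \<gamma>" "x $ iN = \<rho> * sin \<gamma>"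
    unfolding sector_def by blast
  then show "x \<in> sector i1 iN (\<alpha> + 2 * pi) (\<beta> + 2 * pi)"
    unfolding sector_def
    by (intro CollectI exI[of _ "\<gamma> + 2 * pi"] exI[of _ \<rho>]) auto
qed

lemma open_rel_angle_greater: "open {x. t < rel_angle i1 iN \<theta> x}"
  unfolding rel_angle_def
  using continuous_open_preimage[OF continuous_on_rotated_plane open_UNIV open_Arg2pi2pi_gt, of i1 iN \<theta> t]
  by (simp add: vimage_def)

lemma rel_angle_measurable [measurable]: "rel_angle i1 iN \<theta> \<in> borel_measurable borel"
  unfolding borel_measurable_iff_greater
  by (auto intro!: borel_open open_rel_angle_greater)

lemma open_rel_angle_between:
  assumes "0 \<le> \<alpha>" "\<beta> \<le> 2 * pi"
  shows "open {x. \<alpha> < rel_angle i1 iN \<theta> x \<and> rel_angle i1 iN \<theta> x < \<beta>}"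
  unfolding rel_angle_def
  using continuous_open_preimage[OF continuous_on_rotated_plane open_UNIV open_Arg2pi2pi_less_Int[OF assms], of i1 iN \<theta>]
  by (simp add: vimage_def Int_def)

text \<open>
  Although the angle jumps from \<open>0\<close> to \<open>2\<pi>\<close> across the ray through the unit vector, its cosine
  \<open>Re w / |w|\<close> is continuous there and has the value \<open>1\<close>, whereas it is at most some \<open>cos \<delta> < 1\<close> on
  angles between \<open>\<alpha>\<close> and \<open>\<beta>\<close>.
\<close>

lemma rel_angle_avoids_near_unit_dir:
  assumes "i1 \<noteq> iN" "0 < \<alpha>" "\<beta> < 2 * pi"
  obtains r where "0 < r" "\<And>x. x \<in> ball (unit_dir i1 iN \<theta>) r \<Longrightarrow> rel_angle i1 iN \<theta> x \<notin> {\<alpha>..\<beta>}"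
proof -
  define \<delta> where "\<delta> = min (min \<alpha> (2 * pi - \<beta>)) pi"
  have \<delta>: "0 < \<delta>" "\<delta> \<le> pi" "\<delta> \<le> \<alpha>" "\<beta> \<le> 2 * pi - \<delta>"
    using assms by (auto simp: \<delta>_def)
  have cosle: "cos t \<le> cos \<delta>" if "t \<in> {\<alpha>..\<beta>}" for t
  proof (cases "t \<le> pi")
    case True
    then show ?thesis using that \<delta> by (intro cos_monotone_0_pi_le) auto
  next
    case False
    have "cos t = cos (2 * pi - t)" by (simp add: cos_diff)
    also have "\<dots> \<le> cos \<delta>" using that \<delta> False by (intro cos_monotone_0_pi_le) auto
    finally show ?thesis .
  qed
  have "cos \<delta> < cos 0"
    using \<delta> by (intro cos_monotone_0_pi) auto
  let ?w = "rotated_plane i1 iN \<theta>"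
  \<comment> \<open>Clearing the denominator in \<open>Re w / |w| > cos \<delta>\<close> gives a condition continuous even at \<open>w = 0\<close>.\<close>
  have "open {x. cos \<delta> * cmod (?w x) < Re (?w x)}"
    by (intro open_Collect_less continuous_intros)
  moreover have "unit_dir i1 iN \<theta> \<in> {x. cos \<delta> * cmod (?w x) < Re (?w x)}"
    using \<open>cos \<delta> < cos 0\<close> rotated_plane_unit_dir[OF assms(1), of \<theta> \<theta>] by simp
  ultimately obtain r where r: "r > 0" "ball (unit_dir i1 iN \<theta>) r \<subseteq> {x. cos \<delta> * cmod (?w x) < Re (?w x)}"
    by (meson open_contains_ball)
  have "rel_angle i1 iN \<theta> x \<notin> {\<alpha>..\<beta>}" if "x \<in> ball (unit_dir i1 iN \<theta>) r" for x
  proof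
    assume "rel_angle i1 iN \<theta> x \<in> {\<alpha>..\<beta>}"
    then have "cos (Arg2pi (?w x)) \<le> cos \<delta>" using cosle by (simp add: rel_angle_def)
    then have "cmod (?w x) * cos (Arg2pi (?w x)) \<le> cmod (?w x) * cos \<delta>"
      by (intro mult_left_mono) auto
    then show False
      using r that by (auto simp: cos_Arg2pi mult.commute)
  qed
  with r that show ?thesis by blast
qed

text \<open>
  After a further rotation by \<open>t\<close> the points at angle \<open>t\<close> land on the real axis, so they lie in the
  hyperplane orthogonal to the direction \<open>\<theta> + t + \<pi>/2\<close>.
\<close>

lemma negligible_rel_angle_eq:
  assumes "i1 \<noteq> iN"
  shows "negligible {x. rel_angle i1 iN \<theta> x = t}"
proof (rule negligible_subset[OF negligible_hyperplane])
  show "unit_dir i1 iN (\<theta> + t + pi / 2) \<noteq> 0 \<or> (0::real) \<noteq> 0"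
    using norm_unit_dir[OF assms, of "\<theta> + t + pi / 2"] by auto
  show "{x. rel_angle i1 iN \<theta> x = t} \<subseteq> {x. unit_dir i1 iN (\<theta> + t + pi / 2) \<bullet> x = 0}"
  proof safe
    fix x
    assume "t = rel_angle i1 iN \<theta> x" 
    then have "rotated_plane i1 iN \<theta> x * cis (- t) = of_real (cmod (rotated_plane i1 iN \<theta> x))"
      by (subst Arg2pi_polar) (simp add: rel_angle_def mult.assoc cis_mult)
    moreover have "rotated_plane i1 iN (\<theta> + t) x = rotated_plane i1 iN \<theta> x * cis (- t)"
      by (simp add: rotated_plane_def mult.assoc cis_mult algebra_simps)
    ultimately have "Im (rotated_plane i1 iN (\<theta> + t) x) = 0" by simp
    then show "unit_dir i1 iN (\<theta> + rel_angle i1 iN \<theta> x + pi / 2) \<bullet> x = 0"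
      using \<open>t = _\<close> by (simp add: Im_rotated_plane)
  qed
qed

lemma rel_angle_upper_half:
  "0 < rel_angle i1 iN \<theta> x \<and> rel_angle i1 iN \<theta> x < pi \<longleftrightarrow> 0 < Im (rotated_plane i1 iN \<theta> x)"
  by (simp add: rel_angle_def Arg2pi_lt_pi)

lemma rel_angle_lower_half: 
  "pi < rel_angle i1 iN \<theta> x \<longleftrightarrow> Im (rotated_plane i1 iN \<theta> x) < 0"
  using Arg2pi_le_pi[of "rotated_plane i1 iN \<theta> x"] by (auto simp: rel_angle_def)

lemma rel_angle_less_2pi: "rel_angle i1 iN \<theta> x < 2 * pi"
  by (simp add: rel_angle_def Arg2pi)

text \<open>
  The point reflection about the unit vector \<open>e(\<theta>)\<close> acts on the rotated plane as \<open>w \<mapsto> 2 - w\<close> and so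
  changes the sign of the imaginary part. It does not act on the angle by any simple formula, but the
  two half-spaces are all that is needed.
\<close>

lemma rel_angle_reflect:
  assumes "i1 \<noteq> iN"
  shows "pi < rel_angle i1 iN \<theta> (2 *\<^sub>R unit_dir i1 iN \<theta> - x) \<longleftrightarrow>
     0 < rel_angle i1 iN \<theta> x \<and> rel_angle i1 iN \<theta> x < pi"
  unfolding rel_angle_upper_half rel_angle_lower_half
  using rotated_plane_unit_dir[OF assms, of \<theta> \<theta>]
  by (simp add: rotated_plane_diff rotated_plane_scaleR)

lemma rel_angle_unit_dir:
  assumes "i1 \<noteq> iN" "0 \<le> t" "t < 2 * pi"
  shows "rel_angle i1 iN \<theta> (unit_dir i1 iN (\<theta> + t)) = t"
  using assms Arg2pi_cis[of 1 t] by (simp add: rel_angle_def rotated_plane_unit_dir)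

section \<open>The measure with an even singular kernel as density\<close>

lemma measure_Un_fmeasurable:
  "A \<in> fmeasurable N \<Longrightarrow> B \<in> fmeasurable N \<Longrightarrow> A \<inter> B = {} \<Longrightarrow>
   measure N (A \<union> B) = measure N A + measure N B"
  by (rule measure_Union) (auto simp: fmeasurable_def)

lemma exhaustion_measure_unbounded:
  fixes A :: "nat \<Rightarrow> 'a set"
  assumes "\<And>n. A n \<in> fmeasurable N" "incseq A" "emeasure N (\<Union>n. A n) = \<infinity>"
  obtains n where "B < measure N (A n)"
proof -
  have "(SUP n. emeasure N (A n)) = \<infinity>"
    using assms by (subst SUP_emeasure_incseq) (auto simp: fmeasurable_def)
  then have "ennreal (max 0 B) < (SUP n. emeasure N (A n))"
    by (simp only: infinity_ennreal_def ennreal_less_top)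
  then obtain n where "ennreal (max 0 B) < emeasure N (A n)"
    by (auto simp: less_SUP_iff)
  then have "B < measure N (A n)"
    by (simp add: emeasure_eq_measure2[OF assms(1)] ennreal_less_iff)
  then show ?thesis by (rule that)
qed

lemma pi_over_n_small: "0 < x \<Longrightarrow> \<exists>n. pi / real (n + 2) \<le> x"
proof -
  assume "0 < x"
  obtain n :: nat where "pi / x < real n" using reals_Archimedean2 by blast
  with \<open>0 < x\<close> have "pi / real (n + 2) \<le> x" by (simp add: field_simps)
  then show ?thesis ..
qed

lemma emeasure_ball_real:
  "0 \<le> r \<Longrightarrow> emeasure lborel (ball (q :: real ^ 'n::finite) r) = ennreal (unit_ball_vol (real CARD('n)) * r ^ CARD('n))"
  using emeasure_ball[of r q] by simp

lemma sgn_in_sphere: "x \<noteq> p \<Longrightarrow> sgn (x - p) \<in> sphere 0 1" for x p :: "real ^ 'n::finite"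
  by (simp add: norm_sgn)

locale singular_kernel =
  fixes s :: real and a :: "real ^ 'n::finite \<Rightarrow> real" and m M :: real
  assumes s_pos: "0 < s"
    and a_cont: "continuous_on (sphere 0 1) a"
    and m_pos: "0 < m"
    and a_lower: "\<And>\<omega>. \<omega> \<in> sphere 0 1 \<Longrightarrow> m \<le> a \<omega>"
    and a_upper: "\<And>\<omega>. \<omega> \<in> sphere 0 1 \<Longrightarrow> a \<omega> \<le> M"
    and a_even: "\<And>\<omega>. \<omega> \<in> sphere 0 1 \<Longrightarrow> a (- \<omega>) = a \<omega>"
begin

definition kernel_measure :: "real ^ 'n \<Rightarrow> (real ^ 'n) measure" where
  "kernel_measure p = density lborel (\<lambda>x. ennreal (kernel s a p x))"

lemma sets_kernel_measure [measurable_cong, simp]: "sets (kernel_measure p) = sets borel"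
  by (simp add: kernel_measure_def)

lemma space_kernel_measure [simp]: "space (kernel_measure p) = UNIV"
  by (simp add: kernel_measure_def)

lemma M_pos: "0 < M"
proof -
  obtain w :: "real ^ 'n" where "w \<in> sphere 0 1"
    using vector_choose_size[of 1] by (auto simp: dist_norm)
  then show ?thesis using a_lower a_upper m_pos by fastforce
qed

lemma kernel_lower:
  assumes "x \<noteq> p" "norm (x - p) \<le> r"
  shows "m / r powr (real CARD('n) + s) \<le> kernel s a p x"
  unfolding kernel_def
  using assms a_lower[OF sgn_in_sphere[OF assms(1)]] m_pos s_pos
  by (intro frac_le powr_mono2) auto

lemma kernel_upper:
  assumes "0 < r" "r \<le> norm (x - p)"
  shows "kernel s a p x \<le> M / r powr (real CARD('n) + s)"
proof -
  have "x \<noteq> p" using assms by auto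
  then show ?thesis
    unfolding kernel_def
    using assms a_upper[OF sgn_in_sphere] M_pos s_pos
    by (intro frac_le powr_mono2) auto
qed

lemma kernel_nonneg: "0 \<le> kernel s a p x"
  using a_lower[OF sgn_in_sphere, of x p] m_pos
  by (cases "x = p") (auto simp: kernel_def intro!: divide_nonneg_nonneg)

lemma kernel_pos: "x \<noteq> p \<Longrightarrow> 0 < kernel s a p x"
  using a_lower[OF sgn_in_sphere, of x p] m_pos
  by (auto simp: kernel_def intro!: divide_pos_pos)

lemma kernel_measurable [measurable]: "kernel s a p \<in> borel_measurable borel"
proof -
  have "continuous_on (- {p}) (\<lambda>x. a (sgn (x - p)))"
  proof (rule continuous_on_compose2[OF a_cont])
    show "continuous_on (- {p}) (\<lambda>x. sgn (x - p))"
      unfolding sgn_div_norm by (auto intro!: continuous_intros)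
  qed (auto simp: norm_sgn split: if_splits)
  then have "continuous_on (- {p}) (kernel s a p)"
    unfolding kernel_def by (intro continuous_intros) auto
  then have "(\<lambda>x. indicator (- {p}) x *\<^sub>R kernel s a p x) \<in> borel_measurable borel"
    by (intro borel_measurable_continuous_on_indicator) auto
  \<comment> \<open>At \<open>p\<close> the kernel is \<open>0\<close>, being a quotient by \<open>0\<close>, and so agrees with its restriction.\<close>
  also have "(\<lambda>x. indicator (- {p}) x *\<^sub>R kernel s a p x) = kernel s a p"
    by (auto simp: kernel_def indicator_def)
  finally show ?thesis .
qed

lemma kernel_reflect: "kernel s a p (2 *\<^sub>R p - x) = kernel s a p x"
proof (cases "x = p")
  case False
  have "2 *\<^sub>R p - x - p = - (x - p)" by (simp add: scaleR_2)
  then show ?thesis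
    unfolding kernel_def
    using a_even[OF sgn_in_sphere[OF False]] by (simp only: sgn_minus norm_minus_cancel)
qed (simp add: scaleR_2)

lemma emeasure_kernel_measure:
  "X \<in> sets borel \<Longrightarrow>
   emeasure (kernel_measure p) X = (\<integral>\<^sup>+ x. ennreal (kernel s a p x) * indicator X x \<partial>lborel)"
  unfolding kernel_measure_def by (subst emeasure_density) auto

lemma emeasure_kernel_measure_reflect:
  assumes [measurable]: "X \<in> sets borel"
  shows "emeasure (kernel_measure p) ((\<lambda>x. 2 *\<^sub>R p - x) -` X) = emeasure (kernel_measure p) X"
proof -
  have lb: "(lborel :: (real ^ 'n) measure) = distr lborel borel (\<lambda>x. 2 *\<^sub>R p - x)"
    using lborel_affine[of "-1" "2 *\<^sub>R p"] by (simp add: density_1)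
  have "emeasure (kernel_measure p) X = (\<integral>\<^sup>+ x. ennreal (kernel s a p x) * indicator X x \<partial>lborel)"
    by (simp add: emeasure_kernel_measure)
  also have "\<dots> = (\<integral>\<^sup>+ x. ennreal (kernel s a p (2 *\<^sub>R p - x)) * indicator X (2 *\<^sub>R p - x) \<partial>lborel)"
    by (subst lb, subst nn_integral_distr) auto
  also have "\<dots> = (\<integral>\<^sup>+ x. ennreal (kernel s a p x) * indicator ((\<lambda>x. 2 *\<^sub>R p - x) -` X) x \<partial>lborel)"
    by (simp add: kernel_reflect indicator_def)
  also have "\<dots> = emeasure (kernel_measure p) ((\<lambda>x. 2 *\<^sub>R p - x) -` X)"
    using measurable_sets[of "\<lambda>x. 2 *\<^sub>R p - x" borel borel X]
    by (subst emeasure_kernel_measure) auto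
  finally show ?thesis by simp
qed

text \<open>
  Dyadic shells: on the shell of radius comparable to \<open>r\<close> the density is at most \<open>M r\<close> to the power
  \<open>-(n + s)\<close> while the volume is of order \<open>r ^ n\<close>, so the shells contribute a geometric series of ratio
  \<open>2 powr - s\<close>.
\<close>

lemma emeasure_kernel_measure_off_ball:
  assumes "0 < \<rho>"
  shows "emeasure (kernel_measure p) (- ball p \<rho>) < \<infinity>"
proof -
  let ?n = "CARD('n)" and ?\<mu> = "kernel_measure p"
  define shell where "shell k = ball p (2 ^ Suc k * \<rho>) - ball p (2 ^ k * \<rho>)" for k :: nat
  define C where "C = M * \<rho> powr (- s) * 2 ^ ?n * unit_ball_vol (real ?n)"
  have C: "0 \<le> C" using M_pos by (simp add: C_def)
  have [measurable]: "shell k \<in> sets borel" for k by (simp add: shell_def)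
  have "- ball p \<rho> \<subseteq> (\<Union>k. shell k)"
  proof
    fix x assume "x \<in> - ball p \<rho>"
    then have x: "\<rho> \<le> dist p x" by simp
    define k where "k = (LEAST k. dist p x < 2 ^ k * \<rho>)"
    have ex: "\<exists>k. dist p x < 2 ^ k * \<rho>"
      using real_arch_pow[of 2 "dist p x / \<rho>"] assms by (auto simp: field_simps)
    then have k: "dist p x < 2 ^ k * \<rho>" unfolding k_def by (rule LeastI_ex)
    with x have "k \<noteq> 0" by (cases k) auto
    then obtain j where j: "k = Suc j" by (cases k) auto
    then have "\<not> dist p x < 2 ^ j * \<rho>"
      using not_less_Least[of j "\<lambda>k. dist p x < 2 ^ k * \<rho>"] by (simp add: k_def)
    with k j have "x \<in> shell j" by (auto simp: shell_def)
    then show "x \<in> (\<Union>k. shell k)" by blast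
  qed
  then have "emeasure ?\<mu> (- ball p \<rho>) \<le> emeasure ?\<mu> (\<Union>k. shell k)"
    by (intro emeasure_mono) auto
  also have "\<dots> \<le> (\<Sum>k. emeasure ?\<mu> (shell k))"
    by (intro emeasure_subadditive_countably) auto
  also have "\<dots> \<le> (\<Sum>k. ennreal (C * (2 powr - s) ^ k))"
  proof (intro suminf_le)
    fix k
    define r where "r = 2 ^ k * \<rho>"
    have r: "0 < r" using assms by (simp add: r_def)
    have "emeasure ?\<mu> (shell k) =
        (\<integral>\<^sup>+ x. ennreal (kernel s a p x) * indicator (shell k) x \<partial>lborel)"
      by (simp add: emeasure_kernel_measure)
    also have "\<dots> \<le> (\<integral>\<^sup>+ x. ennreal (M / r powr (real ?n + s)) * indicator (ball p (2 * r)) x \<partial>lborel)"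
    proof (rule nn_integral_mono)
      fix x
      show "ennreal (kernel s a p x) * indicator (shell k) x
          \<le> ennreal (M / r powr (real ?n + s)) * indicator (ball p (2 * r)) x"
        using kernel_upper[OF r, of x p]
        by (auto simp: shell_def r_def indicator_def dist_norm norm_minus_commute intro!: ennreal_leI)
    qed
    also have "\<dots> = ennreal (M / r powr (real ?n + s)) * ennreal (unit_ball_vol (real ?n) * (2 * r) ^ ?n)"
      using r by (simp add: nn_integral_cmult_indicator emeasure_ball_real)
    also have "\<dots> = ennreal (M / r powr (real ?n + s) * (unit_ball_vol (real ?n) * (2 * r) ^ ?n))"
      using M_pos r by (intro ennreal_mult[symmetric]) auto
    also have "M / r powr (real ?n + s) * (unit_ball_vol (real ?n) * (2 * r) ^ ?n)
        = C * (2 powr - s) ^ k"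
    proof -
      have "r powr (- s) = (2 powr - s) ^ k * \<rho> powr (- s)"
        using assms by (simp add: r_def powr_mult powr_power powr_realpow[symmetric] powr_powr mult.commute)
      then show ?thesis
        using r by (simp add: C_def powr_add powr_realpow power_mult_distrib powr_minus field_simps)
    qed
    finally show "emeasure ?\<mu> (shell k) \<le> ennreal (C * (2 powr - s) ^ k)" .
  qed auto
  also have "\<dots> = ennreal (\<Sum>k. C * (2 powr - s) ^ k)"
    using C s_pos powr_less_cancel_iff[of 2 "- s" 0]
    by (intro suminf_ennreal2 summable_mult summable_geometric) auto
  also have "\<dots> < \<infinity>" by simp
  finally show ?thesis .
qed

text \<open>
  A ball of radius \<open>t\<close> whose closure meets \<open>p\<close> lies within distance \<open>2 t\<close> of \<open>p\<close>. The lower bound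
  is of order \<open>t powr - s\<close> and blows up as \<open>t\<close> tends to \<open>0\<close>: this is what makes the half-balls
  about \<open>p\<close> have infinite mass, without integrating over them.
\<close>

lemma emeasure_kernel_measure_ball_lower:
  assumes "0 < t" "dist p q \<le> t"
  shows "ennreal (m * unit_ball_vol (real CARD('n)) / (2 powr (real CARD('n) + s) * t powr s))
     \<le> emeasure (kernel_measure p) (ball q t)"
proof -
  let ?n = "CARD('n)"
  let ?c = "m / (2 * t) powr (real ?n + s)"
  have "ennreal (m * unit_ball_vol (real ?n) / (2 powr (real ?n + s) * t powr s))
      = ennreal (?c * (unit_ball_vol (real ?n) * t ^ ?n))"
    using assms by (intro arg_cong[of _ _ ennreal]) (simp add: powr_mult powr_add powr_realpow field_simps)
  also have "\<dots> = ennreal ?c * emeasure lborel (ball q t)"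
    using assms m_pos by (simp add: emeasure_ball_real ennreal_mult del: times_divide_eq_left)
  also have "\<dots> = (\<integral>\<^sup>+ x. ennreal ?c * indicator (ball q t) x \<partial>lborel)"
    by (simp add: nn_integral_cmult_indicator)
  also have "\<dots> \<le> (\<integral>\<^sup>+ x. ennreal (kernel s a p x) * indicator (ball q t) x \<partial>lborel)"
  proof (rule nn_integral_mono_AE, use AE_lborel_singleton[of p] in eventually_elim)
    fix x assume "x \<noteq> p"
    moreover have "norm (x - p) \<le> 2 * t" if "x \<in> ball q t"
      using that assms dist_triangle[of x p q] by (auto simp: dist_norm norm_minus_commute)
    ultimately show "ennreal ?c * indicator (ball q t) x \<le> ennreal (kernel s a p x) * indicator (ball q t) x"
      using kernel_lower[of x p "2 * t"] by (auto simp: indicator_def intro!: ennreal_leI)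
  qed
  also have "\<dots> = emeasure (kernel_measure p) (ball q t)"
    by (simp add: emeasure_kernel_measure)
  finally show ?thesis .
qed

lemma emeasure_kernel_measure_open_pos:
  assumes "open U" "U \<noteq> {}"
  shows "0 < emeasure (kernel_measure p) U"
proof (rule ccontr)
  assume "\<not> 0 < emeasure (kernel_measure p) U"
  then have "U \<in> null_sets (kernel_measure p)"
    using assms by (auto simp: null_sets_def)
  then have "AE x in lborel. x \<in> U \<longrightarrow> ennreal (kernel s a p x) = 0"
    unfolding kernel_measure_def by (subst (asm) null_sets_density_iff) auto
  then have "AE x in lborel. x \<notin> U"
    using AE_lborel_singleton[of p]
    by eventually_elim (metis kernel_pos ennreal_eq_0_iff not_le)
  then have "U \<in> null_sets lborel"
    using assms by (subst AE_iff_null_sets) auto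
  then have "negligible U"
    by (simp add: negligible_iff_null_sets null_sets_completionI)
  with assms show False
    using open_not_negligible by blast
qed

end

section \<open>The principal value and its increments\<close>

locale sector_balance = singular_kernel s a m M
  for s :: real and a :: "real ^ 'n::finite \<Rightarrow> real" and m M :: real +
  fixes i1 iN :: 'n and \<theta> :: real
  assumes distinct_axes: "i1 \<noteq> iN" and theta: "0 < \<theta>" "\<theta> < pi"
begin

abbreviation p :: "real ^ 'n" where "p \<equiv> unit_dir i1 iN \<theta>"
abbreviation h :: "real ^ 'n \<Rightarrow> real" where "h \<equiv> rel_angle i1 iN \<theta>"
abbreviation \<mu> :: "(real ^ 'n) measure" where "\<mu> \<equiv> kernel_measure p"
abbreviation D :: "real \<Rightarrow> real" where "D \<equiv> D_pv i1 iN s a \<theta>"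

lemma sector_right: "\<phi> \<le> 2 * pi \<Longrightarrow> sector i1 iN \<theta> (\<theta> + \<phi>) = {x. 0 < h x \<and> h x < \<phi>}"
  using sector_conv_rel_angle[of 0 \<phi> i1 iN \<theta>] by simp

text \<open>
  Adding a full turn places this sector just below the angle \<open>2\<pi>\<close> relative to \<open>\<theta>\<close>.
\<close>

lemma sector_left: "sector i1 iN 0 \<theta> = {x. 2 * pi - \<theta> < h x}"
  using sector_periodic[of i1 iN 0 \<theta>] sector_conv_rel_angle[of "2 * pi - \<theta>" "2 * pi" i1 iN \<theta>] theta
  by (auto simp: rel_angle_less_2pi)

lemma set_integrable_kernel:
  assumes [measurable]: "A \<in> sets borel" and fin: "emeasure \<mu> A < \<infinity>"
  shows "set_integrable lborel A (kernel s a p)"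
    and "(LINT x : A | lborel. kernel s a p x) = measure \<mu> A"
proof -
  have eq: "indicator A x *\<^sub>R kernel s a p x = kernel s a p x *\<^sub>R indicator A x" for x
    by simp
  have "integrable \<mu> (indicator A :: _ \<Rightarrow> real)"
    using fin by simp
  then show "set_integrable lborel A (kernel s a p)"
    unfolding set_integrable_def eq kernel_measure_def
    by (subst (asm) integrable_density) (auto simp: kernel_nonneg)
  have "measure \<mu> A = integral\<^sup>L \<mu> (indicator A)"
    by simp
  also have "\<dots> = (LINT x : A | lborel. kernel s a p x)"
    unfolding set_lebesgue_integral_def eq kernel_measure_def
    by (subst integral_density) (auto simp: kernel_nonneg)
  finally show "(LINT x : A | lborel. kernel s a p x) = measure \<mu> A"
    by simp
qed

lemma fmeasurable_off_ball:
  assumes "A \<in> sets borel" "0 < \<rho>" "A \<inter> ball p \<rho> = {}"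
  shows "A \<in> fmeasurable \<mu>"
proof -
  have "emeasure \<mu> A \<le> emeasure \<mu> (- ball p \<rho>)"
    using assms by (intro emeasure_mono) auto
  then show ?thesis
    using emeasure_kernel_measure_off_ball[OF assms(2), of p] assms(1)
    by (intro fmeasurableI) (auto simp: less_top[symmetric] top_unique)
qed

lemma trunc_D_eq:
  assumes "\<phi> \<le> 2 * pi" "0 < \<rho>"
  shows "trunc_D i1 iN s a \<theta> \<phi> \<rho> =
    measure \<mu> ({x. 0 < h x \<and> h x < \<phi>} - ball p \<rho>) - measure \<mu> ({x. 2 * pi - \<theta> < h x} - ball p \<rho>)"
proof -
  have "A - ball p \<rho> \<in> fmeasurable \<mu>" if "A \<in> sets borel" for A
    using that assms by (intro fmeasurable_off_ball) auto
  then have "(LINT x : A - ball p \<rho> | lborel. kernel s a p x) = measure \<mu> (A - ball p \<rho>)" 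
    if "A \<in> sets borel" for A
    using that by (intro set_integrable_kernel(2)) (auto simp: fmeasurable_def)
  then show ?thesis
    unfolding trunc_D_def sector_right[OF assms(1)] sector_left by simp
qed

lemma set_integrable_off_ball:
  assumes "A \<in> sets borel" "0 < \<rho>"
  shows "set_integrable lborel (A - ball p \<rho>) (kernel s a p)"
  using fmeasurable_off_ball[of "A - ball p \<rho>" \<rho>] assms
  by (intro set_integrable_kernel(1)) (auto simp: fmeasurable_def)

text \<open>
  The cancellation behind the principal value: the point reflection about \<open>p\<close> preserves both the measure
  and the annulus, and it exchanges the half-spaces.
\<close>

lemma half_annuli_balance:
  "measure \<mu> ({x. pi < h x} \<inter> (ball p r - ball p \<rho>)) =
   measure \<mu> ({x. 0 < h x \<and> h x < pi} \<inter> (ball p r - ball p \<rho>))"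
proof -
  have "(\<lambda>x. 2 *\<^sub>R p - x) -` ({x. pi < h x} \<inter> (ball p r - ball p \<rho>)) =
     {x. 0 < h x \<and> h x < pi} \<inter> (ball p r - ball p \<rho>)"
    using rel_angle_reflect[OF distinct_axes]
    by (auto simp: dist_norm scaleR_2 norm_minus_commute)
  then show ?thesis
    using emeasure_kernel_measure_reflect[of "{x. pi < h x} \<inter> (ball p r - ball p \<rho>)" p]
    by (simp add: measure_def)
qed

lemma measure_diff_ball_split:
  assumes "A \<in> sets borel" "0 < \<rho>" "\<rho> \<le> r"
  shows "measure \<mu> (A - ball p \<rho>) = measure \<mu> (A - ball p r) + measure \<mu> (A \<inter> (ball p r - ball p \<rho>))"
proof -
  have "A - ball p \<rho> = (A - ball p r) \<union> (A \<inter> (ball p r - ball p \<rho>))"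
    using assms subset_ball[of \<rho> r p] by blast
  then show ?thesis
    using assms subset_ball[of \<rho> r p] fmeasurable_off_ball[of "A - ball p r" r]
      fmeasurable_off_ball[of "A \<inter> (ball p r - ball p \<rho>)" \<rho>]
    by (auto intro!: measure_Un_fmeasurable)
qed

text \<open>
  Shrinking the truncation radius adds to each integral the part of its sector inside an annulus.
  Close to \<open>p\<close> these parts are opposite half-annuli, of equal mass.
\<close>

lemma trunc_D_eventually_constant:
  assumes "0 < \<phi>" "\<phi> < 2 * pi"
  obtains r where "0 < r"
    "\<And>\<rho>. 0 < \<rho> \<Longrightarrow> \<rho> \<le> r \<Longrightarrow> trunc_D i1 iN s a \<theta> \<phi> \<rho> = trunc_D i1 iN s a \<theta> \<phi> r"
proof -
  \<comment> \<open>Once the angle avoids all values between these three, it is on the same side of each of them.\<close>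
  have "0 < Min {\<phi>, pi, 2 * pi - \<theta>}" "Max {\<phi>, pi, 2 * pi - \<theta>} < 2 * pi"
    using assms theta by auto
  from rel_angle_avoids_near_unit_dir[OF distinct_axes this, of \<theta>] obtain r where r: "0 < r"
    and avoid: "\<And>x. x \<in> ball p r \<Longrightarrow> h x \<notin> {Min {\<phi>, pi, 2 * pi - \<theta>}..Max {\<phi>, pi, 2 * pi - \<theta>}}"
    by blast
  have "trunc_D i1 iN s a \<theta> \<phi> \<rho> = trunc_D i1 iN s a \<theta> \<phi> r" if \<rho>: "0 < \<rho>" "\<rho> \<le> r" for \<rho>
  proof -
    have near: "{x. 0 < h x \<and> h x < \<phi>} \<inter> (ball p r - ball p \<rho>) = {x. 0 < h x \<and> h x < pi} \<inter> (ball p r - ball p \<rho>)"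
      "{x. 2 * pi - \<theta> < h x} \<inter> (ball p r - ball p \<rho>) = {x. pi < h x} \<inter> (ball p r - ball p \<rho>)"
      using avoid by force+
    show ?thesis
      using measure_diff_ball_split[of "{x. 0 < h x \<and> h x < \<phi>}", OF _ \<rho>]
        measure_diff_ball_split[of "{x. 2 * pi - \<theta> < h x}", OF _ \<rho>] \<rho> r assms
      by (simp add: trunc_D_eq near half_annuli_balance)
  qed
  with r that show ?thesis by blast
qed

lemma trunc_D_tendsto_const:
  assumes "0 < r" "\<And>\<rho>. 0 < \<rho> \<Longrightarrow> \<rho> \<le> r \<Longrightarrow> trunc_D i1 iN s a \<theta> \<phi> \<rho> = c"
  shows "(trunc_D i1 iN s a \<theta> \<phi> \<longlongrightarrow> c) (at_right 0)"
proof (rule tendsto_eventually)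
  show "\<forall>\<^sub>F \<rho> in at_right 0. trunc_D i1 iN s a \<theta> \<phi> \<rho> = c"
    using assms by (auto simp: eventually_at_right_field intro!: exI[of _ r])
qed

lemma D_eq_trunc_D:
  assumes "0 < \<phi>" "\<phi> < 2 * pi"
  obtains r where "0 < r" "\<And>\<rho>. 0 < \<rho> \<Longrightarrow> \<rho> \<le> r \<Longrightarrow> D \<phi> = trunc_D i1 iN s a \<theta> \<phi> \<rho>"
proof -
  obtain r where r: "0 < r"
    and const: "\<And>\<rho>. 0 < \<rho> \<Longrightarrow> \<rho> \<le> r \<Longrightarrow> trunc_D i1 iN s a \<theta> \<phi> \<rho> = trunc_D i1 iN s a \<theta> \<phi> r"
    using trunc_D_eventually_constant[OF assms] by blast
  have "D \<phi> = trunc_D i1 iN s a \<theta> \<phi> r"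
    unfolding D_pv_def
    using trunc_D_tendsto_const[OF r const] by (intro tendsto_Lim) auto
  with r const that show ?thesis by metis
qed

lemma D_well_defined:
  assumes "0 < \<phi>" "\<phi> < 2 * pi"
  shows "D_well_defined i1 iN s a \<theta> \<phi>"
proof -
  obtain r where "0 < r" "\<And>\<rho>. 0 < \<rho> \<Longrightarrow> \<rho> \<le> r \<Longrightarrow> D \<phi> = trunc_D i1 iN s a \<theta> \<phi> \<rho>"
    using D_eq_trunc_D[OF assms] by blast
  then have "(trunc_D i1 iN s a \<theta> \<phi> \<longlongrightarrow> D \<phi>) (at_right 0)"
    by (intro trunc_D_tendsto_const[of r]) auto
  moreover have "set_integrable lborel (sector i1 iN \<theta> (\<theta> + \<phi>) - ball p \<rho>) (kernel s a p)"
    "set_integrable lborel (sector i1 iN 0 \<theta> - ball p \<rho>) (kernel s a p)" if "0 < \<rho>" for \<rho>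
    using assms that by (auto simp: sector_right sector_left intro!: set_integrable_off_ball)
  ultimately show ?thesis
    unfolding D_well_defined_def by blast
qed

lemma fmeasurable_wedge:
  assumes "0 < \<alpha>" "\<beta> < 2 * pi"
  shows "{x. \<alpha> \<le> h x \<and> h x \<le> \<beta>} \<in> fmeasurable \<mu>"
proof -
  obtain r where "0 < r" "\<And>x. x \<in> ball p r \<Longrightarrow> h x \<notin> {\<alpha>..\<beta>}"
    using rel_angle_avoids_near_unit_dir[OF distinct_axes assms, of \<theta>] by blast
  then show ?thesis
    by (intro fmeasurable_off_ball[of _ r]) auto
qed

text \<open>
  At a radius that is small for \<open>\<alpha>\<close> and for \<open>\<beta>\<close>, both values are truncated integrals, and the second
  sector cancels. The wedge \<open>\<alpha> \<le> h < \<beta>\<close> stays away from \<open>p\<close>, so the truncation does not affect it.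
\<close>

lemma D_increment:
  assumes "0 < \<alpha>" "\<alpha> \<le> \<beta>" "\<beta> < 2 * pi"
  shows "D \<beta> = D \<alpha> + measure \<mu> {x. \<alpha> \<le> h x \<and> h x < \<beta>}"
proof -
  have ab: "0 < \<beta>" "\<alpha> < 2 * pi" using assms by auto
  obtain r1 where r1: "0 < r1" "\<And>\<rho>. 0 < \<rho> \<Longrightarrow> \<rho> \<le> r1 \<Longrightarrow> D \<alpha> = trunc_D i1 iN s a \<theta> \<alpha> \<rho>"
    using D_eq_trunc_D[OF assms(1) ab(2)] by blast
  obtain r2 where r2: "0 < r2" "\<And>\<rho>. 0 < \<rho> \<Longrightarrow> \<rho> \<le> r2 \<Longrightarrow> D \<beta> = trunc_D i1 iN s a \<theta> \<beta> \<rho>"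
    using D_eq_trunc_D[OF ab(1) assms(3)] by blast
  obtain r3 where r3: "0 < r3" "\<And>x. x \<in> ball p r3 \<Longrightarrow> h x \<notin> {\<alpha>..\<beta>}"
    using rel_angle_avoids_near_unit_dir[OF distinct_axes assms(1,3), of \<theta>] by blast
  define r where "r = min r1 (min r2 r3)"
  have r: "0 < r" "r \<le> r1" "r \<le> r2" "ball p r \<subseteq> ball p r3"
    using r1 r2 r3 by (auto simp: r_def)
  have "{x. 0 < h x \<and> h x < \<beta>} - ball p r =
      ({x. 0 < h x \<and> h x < \<alpha>} - ball p r) \<union> {x. \<alpha> \<le> h x \<and> h x < \<beta>}"
    using r r3(2) assms by force
  moreover have "measure \<mu> (({x. 0 < h x \<and> h x < \<alpha>} - ball p r) \<union> {x. \<alpha> \<le> h x \<and> h x < \<beta>}) =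
     measure \<mu> ({x. 0 < h x \<and> h x < \<alpha>} - ball p r) + measure \<mu> {x. \<alpha> \<le> h x \<and> h x < \<beta>}"
  proof (rule measure_Un_fmeasurable)
    show "{x. 0 < h x \<and> h x < \<alpha>} - ball p r \<in> fmeasurable \<mu>"
      using r by (intro fmeasurable_off_ball[of _ r]) auto
    show "{x. \<alpha> \<le> h x \<and> h x < \<beta>} \<in> fmeasurable \<mu>"
      using r r3(2) by (intro fmeasurable_off_ball[of _ r]) force+
  qed auto
  ultimately show ?thesis
    using r1(2)[of r] r2(2)[of r] r assms by (simp add: trunc_D_eq)
qed

lemma D_strict_mono:
  assumes "0 < \<alpha>" "\<alpha> < \<beta>" "\<beta> < 2 * pi"
  shows "D \<alpha> < D \<beta>"
proof -
  let ?W = "{x. \<alpha> \<le> h x \<and> h x < \<beta>}" and ?U = "{x. \<alpha> < h x \<and> h x < \<beta>}"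
  have "unit_dir i1 iN (\<theta> + (\<alpha> + \<beta>) / 2) \<in> ?U"
    using assms by (simp add: rel_angle_unit_dir distinct_axes)
  then have "0 < emeasure \<mu> ?U"
    using assms by (intro emeasure_kernel_measure_open_pos open_rel_angle_between) auto
  also have "\<dots> \<le> emeasure \<mu> ?W"
    by (intro emeasure_mono) auto
  finally have "0 < emeasure \<mu> ?W" .
  moreover have "?W \<in> fmeasurable \<mu>"
    by (rule fmeasurableI2[OF fmeasurable_wedge[OF assms(1,3)]]) auto
  ultimately have "0 < measure \<mu> ?W"
    by (simp add: emeasure_eq_measure2)
  then show ?thesis
    using D_increment[of \<alpha> \<beta>] assms by simp
qed

lemma D_mono: "0 < \<alpha> \<Longrightarrow> \<alpha> \<le> \<beta> \<Longrightarrow> \<beta> < 2 * pi \<Longrightarrow> D \<alpha> \<le> D \<beta>"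
  using D_strict_mono[of \<alpha> \<beta>] by (cases "\<alpha> = \<beta>") auto

lemma rel_angle_level_null: "{x. h x = t} \<in> null_sets \<mu>"
proof -
  have "{x. h x = t} \<in> null_sets lborel"
    using negligible_rel_angle_eq[OF distinct_axes, of \<theta> t]
    by (simp add: negligible_iff_null_sets null_sets_completion_iff)
  then have "AE x in lborel. x \<notin> {x. h x = t}"
    by (rule AE_not_in)
  then show ?thesis
    unfolding kernel_measure_def by (subst null_sets_density_iff) (auto elim: eventually_mono)
qed

text \<open>
  Around \<open>t\<close> the function differs by a constant from the cumulative distribution function of the
  angle \<open>h\<close> under the restriction of \<open>\<mu>\<close> to a wedge of finite mass. Such a function is continuous exactly
  at the points without mass, and the level sets of \<open>h\<close> are null.
\<close>

lemma isCont_D: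
  assumes "0 < t" "t < 2 * pi"
  shows "isCont D t"
proof -
  obtain \<alpha> \<beta> where ab: "0 < \<alpha>" "\<alpha> < t" "t < \<beta>" "\<beta> < 2 * pi"
    using dense[OF assms(1)] dense[OF assms(2)] by blast
  define N where "N = distr (restrict_space \<mu> {x. \<alpha> \<le> h x \<and> h x \<le> \<beta>}) borel h"
  have hm: "h \<in> borel_measurable (restrict_space \<mu> {x. \<alpha> \<le> h x \<and> h x \<le> \<beta>})"
    by (intro measurable_restrict_space1) simp
  have N: "emeasure N X = emeasure \<mu> {x. \<alpha> \<le> h x \<and> h x \<le> \<beta> \<and> h x \<in> X}" if "X \<in> sets borel" for X
    using that hm unfolding N_def
    by (auto simp: emeasure_distr emeasure_restrict_space space_restrict_space
        intro!: arg_cong[of _ _ "emeasure \<mu>"])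
  interpret finite_borel_measure N
  proof (intro finite_borel_measure.intro finite_measureI finite_borel_measure_axioms.intro)
    show "emeasure N (space N) \<noteq> \<infinity>"
      using fmeasurable_wedge[OF ab(1,4)] N[of UNIV] by (auto simp: N_def fmeasurable_def)
  qed (simp add: N_def)
  have D_cdf: "D u = D \<alpha> + cdf N u" if "\<alpha> < u" "u < \<beta>" for u
  proof -
    have "emeasure \<mu> ({x. \<alpha> \<le> h x \<and> h x < u} \<union> {x. h x = u}) = emeasure \<mu> {x. \<alpha> \<le> h x \<and> h x < u}"
      using that ab by (intro emeasure_Un_null_set rel_angle_level_null) auto
    also have "{x. \<alpha> \<le> h x \<and> h x < u} \<union> {x. h x = u} = {x. \<alpha> \<le> h x \<and> h x \<le> \<beta> \<and> h x \<in> {..u}}"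
      using that by auto
    finally have "cdf N u = measure \<mu> {x. \<alpha> \<le> h x \<and> h x < u}"
      using N[of "{..u}"] by (simp add: cdf_def measure_def)
    then show ?thesis
      using D_increment[of \<alpha> u] that ab by simp
  qed
  have "{x. \<alpha> \<le> h x \<and> h x \<le> \<beta> \<and> h x \<in> {t}} = {x. h x = t}"
    using ab by auto
  then have "measure N {t} = 0"
    using N[of "{t}"] rel_angle_level_null[of t] by (simp add: measure_def null_setsD1)
  then have "isCont (\<lambda>u. D \<alpha> + cdf N u) t"
    by (intro continuous_intros) (simp add: isCont_cdf)
  moreover have "\<forall>\<^sub>F u in nhds t. D u = D \<alpha> + cdf N u"
    using D_cdf ab by (intro eventually_nhds_in_open[of "{\<alpha><..<\<beta>}", THEN eventually_mono]) auto
  ultimately show ?thesis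
    by (simp add: isCont_cong)
qed

text \<open>
  For every small \<open>t\<close> the half-ball contains the ball of radius \<open>t\<close> that touches the dividing hyperplane
  at \<open>p\<close>, whose mass is at least of order \<open>t powr - s\<close>.
\<close>

lemma emeasure_half_ball:
  assumes "0 < r"
  shows "emeasure \<mu> ({x. 0 < h x \<and> h x < pi} \<inter> ball p r) = \<infinity>"
proof (rule ccontr)
  let ?H = "{x. 0 < h x \<and> h x < pi} \<inter> ball p r"
  let ?\<nu> = "unit_dir i1 iN (\<theta> + pi / 2)"
  assume "emeasure \<mu> ?H \<noteq> \<infinity>"
  then obtain v where v: "0 \<le> v" "emeasure \<mu> ?H = ennreal v"
    by (cases "emeasure \<mu> ?H") auto
  define c where "c = m * unit_ball_vol (real CARD('n)) / 2 powr (real CARD('n) + s)"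
  have c: "0 < c" using m_pos by (simp add: c_def)
  \<comment> \<open>The second argument of the minimum is the solution \<open>t\<close> of \<open>c / t powr s = v + 1\<close>.\<close>
  define t where "t = min (r / 2) ((c / (v + 1)) powr (1 / s))"
  have t: "0 < t" "t \<le> r / 2" "t \<le> (c / (v + 1)) powr (1 / s)"
    using assms c v by (auto simp: t_def)
  have "t powr s \<le> ((c / (v + 1)) powr (1 / s)) powr s"
    using t s_pos by (intro powr_mono2) auto
  also have "\<dots> = c / (v + 1)"
    using s_pos c v by (simp add: powr_powr)
  finally have "v + 1 \<le> c / t powr s"
    using t v by (simp add: field_simps)
  have p_orth: "?\<nu> \<bullet> p = 0"
    using rotated_plane_unit_dir[OF distinct_axes, of \<theta> \<theta>] by (simp flip: Im_rotated_plane)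
  have \<nu>: "norm ?\<nu> = 1" by (rule norm_unit_dir[OF distinct_axes])
  have "ball (p + t *\<^sub>R ?\<nu>) t \<subseteq> ?H"
  proof
    fix x assume "x \<in> ball (p + t *\<^sub>R ?\<nu>) t"
    define y where "y = x - (p + t *\<^sub>R ?\<nu>)"
    have y: "norm y < t" "x = p + t *\<^sub>R ?\<nu> + y"
      using \<open>x \<in> _\<close> by (auto simp: y_def dist_norm norm_minus_commute)
    have "\<bar>?\<nu> \<bullet> y\<bar> \<le> norm y"
      using Cauchy_Schwarz_ineq2[of ?\<nu> y] \<nu> by simp
    then have "0 < t + ?\<nu> \<bullet> y" using y by simp
    also have "t + ?\<nu> \<bullet> y = ?\<nu> \<bullet> x"
      using \<nu> by (simp add: y(2) inner_add_right p_orth flip: power2_norm_eq_inner)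
    finally have "0 < Im (rotated_plane i1 iN \<theta> x)" by (simp add: Im_rotated_plane)
    moreover have "norm (t *\<^sub>R ?\<nu> + y) < r"
      using norm_triangle_ineq[of "t *\<^sub>R ?\<nu>" y] y t \<nu> by simp
    then have "dist x p < r"
      by (simp add: y(2) dist_norm add.commute)
    then have "x \<in> ball p r"
      by (simp add: dist_commute)
    ultimately show "x \<in> ?H"
      using rel_angle_upper_half[of i1 iN \<theta> x] by auto
  qed
  then have "emeasure \<mu> (ball (p + t *\<^sub>R ?\<nu>) t) \<le> ennreal v"
    unfolding v(2)[symmetric] by (intro emeasure_mono) auto
  moreover have "ennreal (c / t powr s) \<le> emeasure \<mu> (ball (p + t *\<^sub>R ?\<nu>) t)"
    using emeasure_kernel_measure_ball_lower[of t p "p + t *\<^sub>R ?\<nu>"] t \<nu> by (simp add: c_def dist_norm)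
  ultimately have "ennreal (c / t powr s) \<le> ennreal v" by (rule order_trans[rotated])
  then show False
    using \<open>v + 1 \<le> c / t powr s\<close> v(1) by (simp add: ennreal_le_iff)
qed

lemma emeasure_upper_wedge: "emeasure \<mu> {x. 0 < h x \<and> h x < pi} = \<infinity>"
proof -
  have "emeasure \<mu> ({x. 0 < h x \<and> h x < pi} \<inter> ball p 1) \<le> emeasure \<mu> {x. 0 < h x \<and> h x < pi}"
    by (intro emeasure_mono) auto
  then show ?thesis by (simp add: emeasure_half_ball top_unique)
qed

lemma emeasure_lower_wedge: "emeasure \<mu> {x. pi < h x} = \<infinity>"
proof -
  have "(\<lambda>x. 2 *\<^sub>R p - x) -` {x. pi < h x} = {x. 0 < h x \<and> h x < pi}"
    using rel_angle_reflect[OF distinct_axes] by auto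
  then show ?thesis
    using emeasure_kernel_measure_reflect[of "{x. pi < h x}" p] emeasure_upper_wedge by simp
qed

section \<open>Limits at the end points and the value equation\<close>

text \<open>
  Exhausting the wedge \<open>0 < h < \<pi>\<close>, of infinite mass, by wedges bounded away from the ray \<open>h = 0\<close> makes
  the increments from a small angle up to \<open>\<pi>\<close> arbitrarily large. Monotonicity passes from the chosen small
  angle to all smaller ones.
\<close>

lemma D_at_bot: "filterlim D at_bot (at_right 0)"
proof (rule filterlim_at_bot[THEN iffD2], intro allI)
  fix B
  define A where "A n = {x. pi / real (n + 2) \<le> h x \<and> h x < pi}" for n
  have eps: "0 < pi / real (n + 2)" "pi / real (n + 2) \<le> pi" for n
    by (auto simp: field_simps)
  have "A n \<in> fmeasurable \<mu>" for n
    unfolding A_def using eps[of n]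
    by (intro fmeasurableI2[OF fmeasurable_wedge[of "pi / real (n + 2)" pi]]) auto
  moreover have "incseq A"
    unfolding incseq_def A_def by (auto elim!: order_trans[rotated] intro!: divide_left_mono)
  moreover have "emeasure \<mu> (\<Union>n. A n) = \<infinity>"
  proof -
    have "{x. 0 < h x \<and> h x < pi} \<subseteq> (\<Union>n. A n)"
      using pi_over_n_small by (auto simp: A_def simp del: of_nat_add)
    then have "emeasure \<mu> {x. 0 < h x \<and> h x < pi} \<le> emeasure \<mu> (\<Union>n. A n)"
      by (intro emeasure_mono) (auto simp: A_def)
    then show ?thesis by (simp add: emeasure_upper_wedge top_unique)
  qed
  ultimately obtain n where n: "D pi - B < measure \<mu> (A n)"
    using exhaustion_measure_unbounded[of A \<mu> "D pi - B"] by metis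
  have "D pi = D (pi / real (n + 2)) + measure \<mu> (A n)"
    unfolding A_def using eps[of n] by (intro D_increment) auto
  then have bound: "D (pi / real (n + 2)) \<le> B" using n by simp
  have "D u \<le> B" if "0 < u" "u < pi / real (n + 2)" for u
    by (rule order_trans[OF D_mono bound]) (use that eps[of n] in auto)
  then show "\<forall>\<^sub>F u in at_right 0. D u \<le> B"
    using eps(1)[of n] unfolding eventually_at_right_field
    by (intro exI[of _ "pi / real (n + 2)"]) auto
qed

lemma D_at_top: "filterlim D at_top (at_left (2 * pi))"
proof (rule filterlim_at_top[THEN iffD2], intro allI)
  fix B
  define A where "A n = {x. pi \<le> h x \<and> h x < 2 * pi - pi / real (n + 2)}" for n
  have eps: "0 < pi / real (n + 2)" "pi / real (n + 2) \<le> pi" for n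
    by (auto simp: field_simps)
  have "A n \<in> fmeasurable \<mu>" for n
    unfolding A_def using eps[of n]
    by (intro fmeasurableI2[OF fmeasurable_wedge[of pi "2 * pi - pi / real (n + 2)"]]) auto
  moreover have "incseq A"
    unfolding incseq_def A_def by (auto elim!: less_le_trans intro!: divide_left_mono)
  moreover have "emeasure \<mu> (\<Union>n. A n) = \<infinity>"
  proof -
    have "{x. pi < h x} \<subseteq> (\<Union>n. A n)"
    proof
      fix x assume x: "x \<in> {x. pi < h x}"
      have "0 < (2 * pi - h x) / 2" using rel_angle_less_2pi[of i1 iN \<theta> x] by simp
      then obtain n where "pi / real (n + 2) \<le> (2 * pi - h x) / 2" using pi_over_n_small by blast
      then have "x \<in> A n" using x rel_angle_less_2pi[of i1 iN \<theta> x] by (simp add: A_def del: of_nat_add)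
      then show "x \<in> (\<Union>n. A n)" by blast
    qed
    then have "emeasure \<mu> {x. pi < h x} \<le> emeasure \<mu> (\<Union>n. A n)"
      by (intro emeasure_mono) (auto simp: A_def)
    then show ?thesis by (simp add: emeasure_lower_wedge top_unique)
  qed
  ultimately obtain n where n: "B - D pi < measure \<mu> (A n)"
    using exhaustion_measure_unbounded[of A \<mu> "B - D pi"] by metis
  let ?e = "2 * pi - pi / real (n + 2)"
  have "D ?e = D pi + measure \<mu> (A n)"
    unfolding A_def using eps[of n] by (intro D_increment) auto
  then have bound: "B \<le> D ?e" using n by simp
  have "B \<le> D u" if "?e < u" "u < 2 * pi" for u
    by (rule order_trans[OF bound D_mono]) (use that eps[of n] in auto)
  then show "\<forall>\<^sub>F u in at_left (2 * pi). B \<le> D u"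
    using eps(1)[of n] unfolding eventually_at_left_field by (intro exI[of _ ?e]) auto
qed

lemma continuous_on_D: "continuous_on {0<..<2 * pi} D"
  by (intro continuous_at_imp_continuous_on) (auto intro: isCont_D)

lemma D_ex1: "\<exists>!\<phi>. \<phi> \<in> {0<..<2 * pi} \<and> D \<phi> = c"
proof (rule ex_ex1I)
  have "\<forall>\<^sub>F u in at_right 0. D u \<le> c \<and> u \<in> {0<..<2 * pi}"
    using D_at_bot by (intro eventually_conj) (auto simp: filterlim_at_bot eventually_at_right_field intro!: exI[of _ "2 * pi"])
  then obtain l where l: "D l \<le> c" "0 < l" "l < 2 * pi"
    using eventually_happens[of _ "at_right (0::real)"] by auto
  have "\<forall>\<^sub>F u in at_left (2 * pi). c \<le> D u \<and> u \<in> {0<..<2 * pi}"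
    using D_at_top by (intro eventually_conj) (auto simp: filterlim_at_top eventually_at_left_field intro!: exI[of _ "0"])
  then obtain u where u: "c \<le> D u" "0 < u" "u < 2 * pi"
    using eventually_happens[of _ "at_left (2 * pi)"] by auto
  have "connected (D ` {0<..<2 * pi})"
    by (intro connected_continuous_image continuous_on_D) simp
  then have "c \<in> D ` {0<..<2 * pi}"
    using l u by (intro connectedD_interval[of _ "D l" "D u" c]) auto
  then show "\<exists>\<phi>. \<phi> \<in> {0<..<2 * pi} \<and> D \<phi> = c" by blast
next
  fix \<phi> \<psi>
  assume "\<phi> \<in> {0<..<2 * pi} \<and> D \<phi> = c" "\<psi> \<in> {0<..<2 * pi} \<and> D \<psi> = c"
  then show "\<phi> = \<psi>"
    using D_strict_mono[of \<phi> \<psi>] D_strict_mono[of \<psi> \<phi>] by (cases \<phi> \<psi> rule: linorder_cases) auto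
qed

end

theorem proposition1p3:
  fixes i1 iN :: "'n::finite" and s1 :: real and a1 :: "real ^ 'n \<Rightarrow> real"
  assumes "i1 \<noteq> iN"
    and "0 < s1" and "s1 < 1"
    and "continuous_on (sphere 0 1) a1"
    and "\<exists>m M. 0 < m \<and> 0 < M \<and> (\<forall>\<omega>\<in>sphere 0 1. m \<le> a1 \<omega> \<and> a1 \<omega> \<le> M)"
    and "\<forall>\<omega>\<in>sphere 0 1. a1 \<omega> = a1 (- \<omega>)"
  shows "(\<forall>\<theta>\<in>{0<..<pi}.
             (\<forall>\<phi>\<in>{0<..<2 * pi}. D_well_defined i1 iN s1 a1 \<theta> \<phi>)
           \<and> continuous_on {0<..<2 * pi} (D_pv i1 iN s1 a1 \<theta>)
           \<and> filterlim (D_pv i1 iN s1 a1 \<theta>) at_bot (at_right 0)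
           \<and> filterlim (D_pv i1 iN s1 a1 \<theta>) at_top (at_left (2 * pi)))
       \<and> (\<forall>c::real. \<forall>\<theta>\<in>{0<..<pi}.
             \<exists>!\<phi>. \<phi> \<in> {0<..<2 * pi} \<and> D_pv i1 iN s1 a1 \<theta> \<phi> = c)"
proof -
  obtain m M where "0 < m" "\<forall>\<omega>\<in>sphere 0 1. m \<le> a1 \<omega> \<and> a1 \<omega> \<le> M"
    using assms(5) by blast
  then have sb: "sector_balance s1 a1 m M i1 iN \<theta>" if "\<theta> \<in> {0<..<pi}" for \<theta>
    using that assms(1-4) assms(6)[THEN bspec, symmetric]
    by (intro sector_balance.intro singular_kernel.intro sector_balance_axioms.intro) (simp_all only: greaterThanLessThan_iff not_False_eq_True)
  show ?thesis
    using sector_balance.D_well_defined[OF sb] sector_balance.continuous_on_D[OF sb]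
      sector_balance.D_at_bot[OF sb] sector_balance.D_at_top[OF sb] sector_balance.D_ex1[OF sb]
    by (intro conjI ballI allI) auto
qed

end
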